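(* Let $\mathfrak t=(m_1,m_2,\infty)$ be the type of an arbitrary triangle group with a single cusp, where $2\le m_1\le m_2<\infty$ are integers with $(m_1,m_2)\neq(2,2)$. Let $E=E_{4,\mathfrak t}$ be the weight-4 automorphic form (Eisenstein series) of this triangle group and $\mathrm D$ its Ramanujan–Serre derivative (both defined in the context). Then $E$ satisfies the following weight-24 differential equation: $$C_{88}E^2(\mathrm D^2E)^2+C_{86}E(\mathrm DE)^2\,\mathrm D^2E+C_{84}E^4\,\mathrm D^2E+C_{66}(\mathrm DE)^4+C_{64}E^3(\mathrm DE)^2+C_{44}E^6=0,$$ where $$C_{88}=m_1^2m_2^2(m_1-2)(m_2-2),$$ $$C_{86}=-m_1^2m_2^2\big((m_1-2)(m_2-3)+(m_2-2)(m_1-3)\big),$$ $$C_{84}=-4m_1m_2(m_1-2)(m_2-2)(m_1m_2-m_1-m_2),$$ $$C_{66}=m_1^2m_2^2(m_1-3)(m_2-3),$$ $$C_{64}=m_1m_2\big(3(m_1-m_2)^2+2m_2(m_2-3)(m_1-2)^2+2m_1(m_1-3)(m_2-2)^2\big),$$ $$C_{44}=4(m_1-2)(m_2-2)(m_1m_2-m_1-m_2)^2.$$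
   Context: Notation: $\mathbb H$ is the upper half-plane with coordinate $\tau$, $h'=\frac{1}{2\pi i}\frac{dh}{d\tau}$, and $q=e^{2\pi i\tau}$. The triangle group of type $\mathfrak t=(m_1,m_2,\infty)$ is the discrete subgroup of $\mathrm{PSL}(2,\mathbb R)$ attached to a hyperbolic triangle with angles $\pi/m_1,\pi/m_2,0$; its cusp is placed at $i\infty$, with local parameter $q$. Its standard hauptmodul $J_{\mathfrak t}$ takes the values $1$, $0$, $\infty$ at the elliptic point of order $m_1$, the elliptic point of order $m_2$ and the cusp. Put $z=1/(1-J_{\mathfrak t}(\tau))$, so $z\to0$ as $\tau\to i\infty$. Put $a=\frac12\left(1-\frac1{m_1}+\frac1{m_2}\right)$, $b=\frac12\left(1-\frac1{m_1}-\frac1{m_2}\right)$, $c=\frac12\left(1+\frac1{m_1}-\frac1{m_2}\right)$. The generalized Halphen system of type $\mathfrak t$ is $$t_1'=(a-1)(t_1t_2+t_1t_3-t_2t_3)+(b+c-1)t_1^2,$$ $$t_2'=(b-1)(t_2t_3+t_2t_1-t_1t_3)+(a+c-1)t_2^2,$$ $$t_3'=(c-1)(t_3t_1+t_3t_2-t_1t_2)+(a+b-1)t_3^2.$$ Throughout, $t_1,t_2,t_3$ denote the following particular solution (near $i\infty$, continued analytically in $\tau$): $$t_1=\kappa(a-1)z(1-z)^{b-a}\,{}_2F_1(1-a,b;1;z)\,{}_2F_1(2-a,b;2;z),$$ $$t_2-t_1=\kappa(1-z)^{b-a}\,{}_2F_1(1-a,b;1;z)^2,\qquad t_3-t_1=\kappa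 z(1-z)^{b-a}\,{}_2F_1(1-a,b;1;z)^2,$$ where ${}_2F_1$ is the Gauss hypergeometric function and the constant $\kappa$ is fixed by requiring $E_{2,\mathfrak t}=1+O(q)$ as $\tau\to i\infty$ for the function $E_{2,\mathfrak t}$ below. Eisenstein series: put $\mathsf x=t_1-t_2$ and $\mathsf y=t_3-t_2$. Then $E_{4,\mathfrak t}=\mathsf x\mathsf y$ is a holomorphic automorphic form of weight 4 for the triangle group, and $$E_{2,\mathfrak t}=\frac{1}{m_1+m_2-m_1m_2}\big(2m_1\mathsf x+2m_2\mathsf y+(m_1+m_2+m_1m_2)\,t_2\big)$$ is its holomorphic quasi-automorphic weight-2 Eisenstein series. Ramanujan–Serre derivative: on an automorphic form $f$ of weight $k$, $$\mathrm Df=f'-\frac k2\left(1-\frac1{m_1}-\frac1{m_2}\right)E_{2,\mathfrak t}f,$$ which is an automorphic form of weight $k+2$. So $\mathrm DE_{4,\mathfrak t}$ uses $k=4$, and $\mathrm D^2E_{4,\mathfrak t}=\mathrm D(\mathrm DE_{4,\mathfrak t})$ applies $\mathrm D$ with $k=6$ to $\mathrm DE_{4,\mathfrak t}$. *)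

theory Defs
  imports "HOL-Complex_Analysis.Complex_Analysis" "HOL-Library.Landau_Symbols"
begin

definition upper_half_plane :: "complex set" where
  "upper_half_plane = {\<tau>. Im \<tau> > 0}"

text \<open>The filter of neighbourhoods of the cusp: imaginary part tending to infinity, uniformly in
  the real part.\<close>

definition at_i_inf :: "complex filter" where
  "at_i_inf = filtercomap Im at_top"

definition nome :: "complex \<Rightarrow> complex" where
  "nome \<tau> = exp (2 * of_real pi * \<i> * \<tau>)"

definition qderiv :: "(complex \<Rightarrow> complex) \<Rightarrow> complex \<Rightarrow> complex" where
  "qderiv h \<tau> = deriv h \<tau> / (2 * of_real pi * \<i>)"


section \<open>The triangle group and its hauptmodul\<close>

text \<open>The hyperbolic triangle with angles \<open>\<pi>/m1\<close>, \<open>\<pi>/m2\<close>, \<open>0\<close> and ideal vertex at infinity is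
  bounded by two vertical lines and an arc of a circle with real centre \<open>s\<close> and radius \<open>R\<close>. The arc
  meets the lines in the other two vertices, \<open>s - R exp (- i \<pi>/m1)\<close> and \<open>s + R exp (i \<pi>/m2)\<close>. The
  composition of the reflections in the lines is the translation by twice their distance
  \<open>R (cos (\<pi>/m1) + cos (\<pi>/m2))\<close>; for \<open>q = exp (2 \<pi> i \<tau>)\<close> to be a local parameter at the cusp this
  translation has to be by \<open>1\<close>, which determines \<open>R\<close>. The centre \<open>s\<close> remains arbitrary.\<close>

definition tri_radius :: "int \<Rightarrow> int \<Rightarrow> real" where
  "tri_radius m1 m2 = 1 / (2 * (cos (pi / of_int m1) + cos (pi / of_int m2)))"

definition vertex1 :: "int \<Rightarrow> int \<Rightarrow> real \<Rightarrow> complex" where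
  "vertex1 m1 m2 s = of_real s - of_real (tri_radius m1 m2) * cis (- pi / of_int m1)"

definition vertex2 :: "int \<Rightarrow> int \<Rightarrow> real \<Rightarrow> complex" where
  "vertex2 m1 m2 s = of_real s + of_real (tri_radius m1 m2) * cis (pi / of_int m2)"

definition refl_line :: "real \<Rightarrow> complex \<Rightarrow> complex" where
  "refl_line x \<tau> = 2 * of_real x - cnj \<tau>"

definition refl_circle :: "real \<Rightarrow> real \<Rightarrow> complex \<Rightarrow> complex" where
  "refl_circle s R \<tau> = of_real s + of_real (R\<^sup>2) / (cnj \<tau> - of_real s)"

definition side_reflections :: "int \<Rightarrow> int \<Rightarrow> real \<Rightarrow> (complex \<Rightarrow> complex) set" where
  "side_reflections m1 m2 s =
     {refl_line (Re (vertex1 m1 m2 s)), refl_line (Re (vertex2 m1 m2 s)),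
      refl_circle s (tri_radius m1 m2)}"

text \<open>The orientation preserving subgroup of the group generated by the reflections in the sides.
  Elements of \<open>PSL(2,\<real>)\<close> are represented by the maps they induce; these are only used on the upper
  half-plane, where no denominator vanishes. Reflections are involutions, so no inverses have to be
  added.\<close>

inductive_set triangle_group :: "int \<Rightarrow> int \<Rightarrow> real \<Rightarrow> (complex \<Rightarrow> complex) set"
  for m1 m2 :: int and s :: real where
  "id \<in> triangle_group m1 m2 s"
| "\<lbrakk>\<gamma> \<in> triangle_group m1 m2 s; \<rho> \<in> side_reflections m1 m2 s; \<sigma> \<in> side_reflections m1 m2 s\<rbrakk>
     \<Longrightarrow> \<rho> \<circ> \<sigma> \<circ> \<gamma> \<in> triangle_group m1 m2 s"

text \<open>\<open>J\<close> induces a holomorphic bijection from the quotient of the upper half-plane onto the complex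
  plane, extended by \<open>\<infinity>\<close> at the cusp.\<close>

definition standard_hauptmodul :: "int \<Rightarrow> int \<Rightarrow> real \<Rightarrow> (complex \<Rightarrow> complex) \<Rightarrow> bool" where
  "standard_hauptmodul m1 m2 s J \<longleftrightarrow>
     J holomorphic_on upper_half_plane \<and>
     (\<forall>\<tau>\<in>upper_half_plane. \<forall>\<tau>'\<in>upper_half_plane.
        J \<tau> = J \<tau>' \<longleftrightarrow> (\<exists>\<gamma>\<in>triangle_group m1 m2 s. \<gamma> \<tau> = \<tau>')) \<and>
     J ` upper_half_plane = UNIV \<and>
     J (vertex1 m1 m2 s) = 1 \<and>
     J (vertex2 m1 m2 s) = 0 \<and>
     filterlim J at_infinity at_i_inf"


section \<open>The Halphen system\<close>

definition par_a :: "int \<Rightarrow> int \<Rightarrow> complex" where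
  "par_a m1 m2 = 1/2 * (1 - 1 / of_int m1 + 1 / of_int m2)"

definition par_b :: "int \<Rightarrow> int \<Rightarrow> complex" where
  "par_b m1 m2 = 1/2 * (1 - 1 / of_int m1 - 1 / of_int m2)"

definition par_c :: "int \<Rightarrow> int \<Rightarrow> complex" where
  "par_c m1 m2 = 1/2 * (1 + 1 / of_int m1 - 1 / of_int m2)"

definition halphen_system ::
  "complex \<Rightarrow> complex \<Rightarrow> complex \<Rightarrow> (complex \<Rightarrow> complex) \<Rightarrow> (complex \<Rightarrow> complex) \<Rightarrow>
     (complex \<Rightarrow> complex) \<Rightarrow> complex set \<Rightarrow> bool" where
  "halphen_system a b c t1 t2 t3 U \<longleftrightarrow> (\<forall>\<tau>\<in>U.
     qderiv t1 \<tau> = (a - 1) * (t1 \<tau> * t2 \<tau> + t1 \<tau> * t3 \<tau> - t2 \<tau> * t3 \<tau>) + (b + c - 1) * (t1 \<tau>)\<^sup>2 \<and>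
     qderiv t2 \<tau> = (b - 1) * (t2 \<tau> * t3 \<tau> + t2 \<tau> * t1 \<tau> - t1 \<tau> * t3 \<tau>) + (a + c - 1) * (t2 \<tau>)\<^sup>2 \<and>
     qderiv t3 \<tau> = (c - 1) * (t3 \<tau> * t1 \<tau> + t3 \<tau> * t2 \<tau> - t1 \<tau> * t2 \<tau>) + (a + b - 1) * (t3 \<tau>)\<^sup>2)"

definition hyp2F1 :: "complex \<Rightarrow> complex \<Rightarrow> complex \<Rightarrow> complex \<Rightarrow> complex" where
  "hyp2F1 a b c z = eval_fps (fps_hypergeo [a, b] [c] 1) z"

text \<open>The functions \<open>t1, t2, t3\<close> have poles at elliptic points, i.e. where \<open>J\<close> is \<open>0\<close> or \<open>1\<close>, so
  they are continued analytically to the complement of these points only. Near the cusp \<open>z\<close> is close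
  to \<open>0\<close>, so the hypergeometric series converge and the power of \<open>1 - z\<close> is the principal one.\<close>

definition regular_points :: "(complex \<Rightarrow> complex) \<Rightarrow> complex set" where
  "regular_points J = {\<tau> \<in> upper_half_plane. J \<tau> \<noteq> 0 \<and> J \<tau> \<noteq> 1}"

definition halphen_solution ::
  "int \<Rightarrow> int \<Rightarrow> (complex \<Rightarrow> complex) \<Rightarrow> complex \<Rightarrow> (complex \<Rightarrow> complex) \<Rightarrow>
     (complex \<Rightarrow> complex) \<Rightarrow> (complex \<Rightarrow> complex) \<Rightarrow> bool" where
  "halphen_solution m1 m2 J \<kappa> t1 t2 t3 \<longleftrightarrow>
     (let a = par_a m1 m2; b = par_b m1 m2; c = par_c m1 m2 in
       t1 holomorphic_on regular_points J \<and>
       t2 holomorphic_on regular_points J \<and>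
       t3 holomorphic_on regular_points J \<and>
       halphen_system a b c t1 t2 t3 (regular_points J) \<and>
       (\<forall>\<^sub>F \<tau> in at_i_inf. let z = 1 / (1 - J \<tau>) in
          t1 \<tau> = \<kappa> * (a - 1) * z * (1 - z) powr (b - a)
                    * hyp2F1 (1 - a) b 1 z * hyp2F1 (2 - a) b 2 z \<and>
          t2 \<tau> - t1 \<tau> = \<kappa> * (1 - z) powr (b - a) * (hyp2F1 (1 - a) b 1 z)\<^sup>2 \<and>
          t3 \<tau> - t1 \<tau> = \<kappa> * z * (1 - z) powr (b - a) * (hyp2F1 (1 - a) b 1 z)\<^sup>2))"


section \<open>Eisenstein series and the Ramanujan--Serre derivative\<close>

text \<open>The singularities at the elliptic points cancel in the Eisenstein series; their values there
  are given by continuity.\<close>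

definition eisenstein4 ::
  "(complex \<Rightarrow> complex) \<Rightarrow> (complex \<Rightarrow> complex) \<Rightarrow> (complex \<Rightarrow> complex) \<Rightarrow> complex \<Rightarrow> complex" where
  "eisenstein4 t1 t2 t3 = remove_sings (\<lambda>\<tau>. (t1 \<tau> - t2 \<tau>) * (t3 \<tau> - t2 \<tau>))"

definition eisenstein2 ::
  "int \<Rightarrow> int \<Rightarrow> (complex \<Rightarrow> complex) \<Rightarrow> (complex \<Rightarrow> complex) \<Rightarrow> (complex \<Rightarrow> complex) \<Rightarrow>
     complex \<Rightarrow> complex" where
  "eisenstein2 m1 m2 t1 t2 t3 = remove_sings (\<lambda>\<tau>.
     1 / of_int (m1 + m2 - m1 * m2) *
       (2 * of_int m1 * (t1 \<tau> - t2 \<tau>) + 2 * of_int m2 * (t3 \<tau> - t2 \<tau>)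
        + of_int (m1 + m2 + m1 * m2) * t2 \<tau>))"

definition serre_deriv ::
  "int \<Rightarrow> int \<Rightarrow> (complex \<Rightarrow> complex) \<Rightarrow> nat \<Rightarrow> (complex \<Rightarrow> complex) \<Rightarrow> complex \<Rightarrow> complex" where
  "serre_deriv m1 m2 E2 k f \<tau> =
     qderiv f \<tau> - of_nat k / 2 * (1 - 1 / of_int m1 - 1 / of_int m2) * E2 \<tau> * f \<tau>"


section \<open>Coefficients of the differential equation\<close>

definition C88 :: "int \<Rightarrow> int \<Rightarrow> int" where
  "C88 m1 m2 = m1^2 * m2^2 * (m1 - 2) * (m2 - 2)"

definition C86 :: "int \<Rightarrow> int \<Rightarrow> int" where
  "C86 m1 m2 = - (m1^2 * m2^2 * ((m1 - 2) * (m2 - 3) + (m2 - 2) * (m1 - 3)))"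

definition C84 :: "int \<Rightarrow> int \<Rightarrow> int" where
  "C84 m1 m2 = - 4 * m1 * m2 * (m1 - 2) * (m2 - 2) * (m1 * m2 - m1 - m2)"

definition C66 :: "int \<Rightarrow> int \<Rightarrow> int" where
  "C66 m1 m2 = m1^2 * m2^2 * (m1 - 3) * (m2 - 3)"

definition C64 :: "int \<Rightarrow> int \<Rightarrow> int" where
  "C64 m1 m2 = m1 * m2 * (3 * (m1 - m2)^2 + 2 * m2 * (m2 - 3) * (m1 - 2)^2
                                       + 2 * m1 * (m1 - 3) * (m2 - 2)^2)"

definition C44 :: "int \<Rightarrow> int \<Rightarrow> int" where
  "C44 m1 m2 = 4 * (m1 - 2) * (m2 - 2) * (m1 * m2 - m1 - m2)^2"

end

theory Submission
  imports Defs
begin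

text \<open>Put \<open>x = t1 - t2\<close> and \<open>y = t3 - t2\<close>. The hypergeometric formulas enter only through
  \<open>t3 - t1 = z (t2 - t1)\<close>, which the identity theorem spreads from the cusp to all regular points.
  Together with the Halphen system it yields \<open>J' = - J x = (1 - J) y\<close>. On regular points both
  Serre derivatives of \<open>E = x y\<close> are \<open>E\<close> times a form in \<open>x, y\<close> alone, and the differential
  equation is a quartic identity between binary forms. If \<open>x\<close> vanishes identically, so does \<open>E\<close>.

  At an elliptic point the functions have at most simple poles. The residues of \<open>x\<close> and \<open>t2\<close> are
  determined by the order of \<open>J\<close> and the Halphen system; the Riccati equation for \<open>t2\<close> then forces
  the order to be \<open>m2\<close> (or \<open>m1\<close>, at points with \<open>J = 1\<close>). Hence the poles cancel in \<open>E\<close> and \<open>E2\<close>, and the differential equation extends by continuity.\<close>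

text \<open>The product \<open>(w - p) * f w\<close> extends holomorphically to \<open>p\<close>, so
  its derivative \<open>f w + (w - p) * deriv f w\<close> has a finite limit. Multiplying by
  \<open>w - p\<close> sends that limit to 0 and leaves the coefficient of the double pole.\<close>

lemma deriv_simple_pole_tendsto:
  fixes f :: "complex \<Rightarrow> complex"
  assumes "open A" "p \<in> A" and hol: "f holomorphic_on A - {p}"
    and lim: "(\<lambda>w. (w - p) * f w) \<midarrow>p\<rightarrow> r"
  shows "(\<lambda>w. (w - p)\<^sup>2 * deriv f w) \<midarrow>p\<rightarrow> - r"
proof -
  define g where "g = (\<lambda>w. (w - p) * f w)"
  have dg: "(g has_field_derivative f w + (w - p) * deriv f w) (at w)" if "w \<in> A - {p}" for w
  proof -
    have "(f has_field_derivative deriv f w) (at w)"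
      using that assms by (intro holomorphic_derivI[OF hol]) auto
    then show ?thesis
      unfolding g_def by (auto intro!: derivative_eq_intros)
  qed
  obtain c where c: "(\<lambda>w. f w + (w - p) * deriv f w) \<midarrow>p\<rightarrow> c"
    using removable_singularity_deriv'[OF _ assms(2,1) dg] lim unfolding g_def by blast
  have "(\<lambda>w. (w - p) * (f w + (w - p) * deriv f w) - (w - p) * f w) \<midarrow>p\<rightarrow> (p - p) * c - r"
    by (intro tendsto_intros c lim)
  then show ?thesis
    by (simp add: algebra_simps power2_eq_square)
qed

text \<open>Extended by 0 at \<open>p\<close>, the product \<open>(w - p) * f w\<close> is
  holomorphic and \<open>f\<close> is its difference quotient at \<open>p\<close>, so the limit
  exists as a derivative.\<close>

lemma removable_of_zero_residue:
  fixes f :: "complex \<Rightarrow> complex"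
  assumes "open A" "p \<in> A" and hol: "f holomorphic_on A - {p}"
    and lim: "(\<lambda>w. (w - p) * f w) \<midarrow>p\<rightarrow> 0"
  shows "\<exists>c. f \<midarrow>p\<rightarrow> c"
proof -
  define H where "H = (\<lambda>w. if w = p then 0 else (w - p) * f w)"
  have "H holomorphic_on A"
    unfolding H_def
    by (rule removable_singularity[OF _ assms(1) lim]) (intro holomorphic_intros hol)
  then have "(H has_field_derivative deriv H p) (at p)"
    using assms by (auto intro: holomorphic_derivI)
  then have "(\<lambda>w. (H w - H p) / (w - p)) \<midarrow>p\<rightarrow> deriv H p"
    by (simp add: has_field_derivative_iff)
  moreover have "eventually (\<lambda>w. (H w - H p) / (w - p) = f w) (at p)"
    by (auto simp: H_def eventually_at_filter)
  ultimately show ?thesis by (auto dest: Lim_transform_eventually)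
qed

lemma remove_sings_holomorphic_on:
  assumes "open S"
    and "\<And>p. p \<in> S \<Longrightarrow> isolated_singularity_at f p"
    and "\<And>p. p \<in> S \<Longrightarrow> \<exists>c. f \<midarrow>p\<rightarrow> c"
  shows "remove_sings f holomorphic_on S"
proof -
  have "remove_sings f analytic_on {p}" if "p \<in> S" for p
    using assms(2,3)[OF that] remove_sings_analytic_at by blast
  then show ?thesis
    using analytic_imp_holomorphic analytic_on_analytic_at by blast
qed

text \<open>The functions are kept abstract so that one statement serves both kinds of elliptic
  points: it applies to \<open>J\<close> where \<open>J = 0\<close>, and to \<open>1 - J\<close>
  where \<open>J = 1\<close>, after interchanging \<open>x\<close> with \<open>y\<close> and
  \<open>m1\<close> with \<open>m2\<close>. The constant \<open>S\<close> and the equation for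
  \<open>t\<close> are invariant under this exchange. Laurent coefficients at \<open>p\<close> are
  read off as limits.\<close>

lemma elliptic_point_limits:
  fixes m1 m2 :: int and J x y t :: "complex \<Rightarrow> complex"
  defines "S \<equiv> - (1 + 1 / of_int m1 + 1 / of_int m2) / 2 :: complex"
  assumes m: "m1 \<ge> 2" "m2 \<ge> 2" and "r > 0"
    and holJ: "J holomorphic_on ball p r" and J0: "J p = 0"
    and Jnz: "\<And>w. w \<in> ball p r - {p} \<Longrightarrow> J w \<noteq> 0"
    and holx: "x holomorphic_on ball p r - {p}" and holt: "t holomorphic_on ball p r - {p}"
    and holy: "y holomorphic_on ball p r - {p}"
    and dJx: "\<And>w. w \<in> ball p r - {p} \<Longrightarrow> qderiv J w = - J w * x w"
    and dJy: "\<And>w. w \<in> ball p r - {p} \<Longrightarrow> qderiv J w = (1 - J w) * y w"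
    and dx: "\<And>w. w \<in> ball p r - {p} \<Longrightarrow>
      qderiv x w = x w * (2 * S * t w - (1 / of_int m1 + 1) * y w - x w / of_int m2)"
    and dt: "\<And>w. w \<in> ball p r - {p} \<Longrightarrow> qderiv t w = S * ((t w)\<^sup>2 - x w * y w)"
  shows "\<exists>c. (\<lambda>w. x w * y w) \<midarrow>p\<rightarrow> c"
    and "\<exists>c. (\<lambda>w. 2 * of_int m1 * x w + 2 * of_int m2 * y w + of_int (m1 + m2 + m1 * m2) * t w)
           \<midarrow>p\<rightarrow> c"
proof -
  define N :: complex where "N = 1 / (2 * of_real pi * \<i>)"
  have N0: "N \<noteq> 0" by (simp add: N_def)
  have qd: "qderiv f w = N * deriv f w" for f w
    by (simp add: qderiv_def N_def)
  define M1 M2 :: complex where "M1 = of_int m1" and "M2 = of_int m2"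
  have M: "M1 \<noteq> 0" "M2 \<noteq> 0" using m by (auto simp: M1_def M2_def)
  have S2: "2 * M1 * M2 * S = - (M1 * M2 + M1 + M2)"
    using M by (simp add: S_def M1_def M2_def field_simps)
  have "M1 * M2 + M1 + M2 = of_int (m1 * m2 + m1 + m2)"
    by (simp add: M1_def M2_def)
  moreover have "m1 * m2 + m1 + m2 > 0" using m by (simp add: add_pos_pos)
  ultimately have "M1 * M2 + M1 + M2 \<noteq> 0" by (metis of_int_eq_0_iff less_irrefl)
  then have S0: "S \<noteq> 0" using S2 by (metis mult_zero_right neg_equal_0_iff_equal)
  have near: "eventually (\<lambda>w. w \<in> ball p r - {p}) (at p)"
    using \<open>r > 0\<close> by (intro eventually_at_in_open) auto
  have nonconst: "\<not> J constant_on ball p r"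
  proof
    assume *: "J constant_on ball p r"
    have "eventually (\<lambda>w. J w = 0) (at p)"
      using near by eventually_elim (use * J0 \<open>r > 0\<close> in \<open>auto simp: constant_on_def\<close>)
    then have "eventually (\<lambda>w. False) (at p)"
      using near by eventually_elim (use Jnz in auto)
    then show False by simp
  qed
  obtain g \<rho> n where n: "0 < n" and \<rho>: "0 < \<rho>" "ball p \<rho> \<subseteq> ball p r"
    and holg: "g holomorphic_on ball p \<rho>"
    and Jg: "\<And>w. w \<in> ball p \<rho> \<Longrightarrow> J w = (w - p) ^ n * g w"
    and gnz: "\<And>w. w \<in> ball p \<rho> \<Longrightarrow> g w \<noteq> 0"
    by (rule holomorphic_factor_zero_nonconstant[OF holJ open_ball connected_ball _ J0 nonconst])
      (use \<open>r > 0\<close> in auto)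
  have near\<rho>: "eventually (\<lambda>w. w \<in> ball p \<rho> - {p}) (at p)"
    using \<rho> by (intro eventually_at_in_open) auto
  have contJ: "J \<midarrow>p\<rightarrow> 0"
    using holomorphic_on_imp_continuous_on[OF holJ] \<open>r > 0\<close> J0
    by (metis centre_in_ball continuous_on_eq_continuous_at isContD open_ball)
  have g_lim: "g \<midarrow>p\<rightarrow> g p"
    using holomorphic_on_imp_continuous_on[OF holg] \<rho>
    by (metis centre_in_ball continuous_on_eq_continuous_at isContD open_ball)
  have dg_lim: "deriv g \<midarrow>p\<rightarrow> deriv g p"
    using holomorphic_on_imp_continuous_on[OF holomorphic_deriv[OF holg open_ball]] \<rho>
    by (metis centre_in_ball continuous_on_eq_continuous_at isContD open_ball)
  have dJ: "deriv J w = of_nat n * (w - p) ^ (n - 1) * g w + (w - p) ^ n * deriv g w"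
    if "w \<in> ball p \<rho>" for w
  proof -
    have "((\<lambda>w. (w - p) ^ n * g w) has_field_derivative
        of_nat n * (w - p) ^ (n - 1) * g w + (w - p) ^ n * deriv g w) (at w)"
      using holomorphic_derivI[OF holg open_ball that]
      by (auto intro!: derivative_eq_intros)
    moreover have "eventually (\<lambda>w. J w = (w - p) ^ n * g w) (nhds w)"
      using eventually_nhds_in_open[OF open_ball that] by eventually_elim (rule Jg)
    ultimately show ?thesis
      by (metis DERIV_imp_deriv deriv_cong_ev)
  qed
  \<comment> \<open>Up to the factor \<open>- N\<close>, \<open>x\<close> is the logarithmic
    derivative of \<open>J\<close>, so its residue records the order \<open>n\<close> of the
    zero.\<close>
  have x_eq: "(w - p) * x w = - N * (of_nat n + (w - p) * deriv g w / g w)"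
    if "w \<in> ball p \<rho> - {p}" for w
  proof -
    have w: "w \<noteq> p" "g w \<noteq> 0" "J w \<noteq> 0" "w \<in> ball p r - {p}" "w \<in> ball p \<rho>"
      using that gnz Jnz \<rho> by auto
    have factor: "- N * (a * P * G + D * P * G') = P * G * (- N * (a + D * G' / G))"
      if "G \<noteq> 0" for a P G D G'
      using that by (simp add: field_simps)
    have pw: "(w - p) ^ n = (w - p) * (w - p) ^ (n - 1)"
      using n by (cases n) auto
    have e: "N * deriv J w = - J w * x w"
      using dJx[of w] w by (simp add: qd)
    have "J w * ((w - p) * x w) = - (w - p) * (N * deriv J w)"
      unfolding e by (simp add: algebra_simps)
    also have "\<dots> = - N * (of_nat n * (w - p) ^ n * g w + (w - p) * (w - p) ^ n * deriv g w)"
      unfolding dJ[OF w(5)] pw by (simp add: algebra_simps)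
    also have "\<dots> = J w * (- N * (of_nat n + (w - p) * deriv g w / g w))"
      unfolding Jg[OF w(5)] by (rule factor) (rule w)
    finally show ?thesis by (rule mult_left_cancel[OF w(3), THEN iffD1])
  qed
  have x_lim: "(\<lambda>w. (w - p) * x w) \<midarrow>p\<rightarrow> - N * of_nat n"
  proof -
    have "(\<lambda>w. - N * (of_nat n + (w - p) * deriv g w / g w)) \<midarrow>p\<rightarrow>
        - N * (of_nat n + (p - p) * deriv g p / g p)"
      by (intro tendsto_intros g_lim dg_lim gnz) (use \<rho> in auto)
    moreover have "eventually (\<lambda>w. - N * (of_nat n + (w - p) * deriv g w / g w) = (w - p) * x w) (at p)"
      using near\<rho> by eventually_elim (use x_eq in auto)
    ultimately show ?thesis by (simp add: tendsto_cong)
  qed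
  \<comment> \<open>The second formula for the derivative of \<open>J\<close> is solved for
    \<open>y\<close>. As \<open>J p = 0\<close>, the denominator tends to 1 and \<open>y\<close> has
    no pole.\<close>
  define Y where "Y = (\<lambda>w. N * deriv J w / (1 - J w))"
  have nearJ1: "eventually (\<lambda>w. J w \<noteq> 1) (at p)"
    using contJ by (rule tendsto_imp_eventually_ne) auto
  have y_eq: "eventually (\<lambda>w. y w = Y w) (at p)"
    using near nearJ1 by eventually_elim (use dJy in \<open>auto simp: Y_def qd field_simps\<close>)
  have dJ_lim: "deriv J \<midarrow>p\<rightarrow> deriv J p"
    using holomorphic_on_imp_continuous_on[OF holomorphic_deriv[OF holJ open_ball]] \<open>r > 0\<close>
    by (metis centre_in_ball continuous_on_eq_continuous_at isContD open_ball)
  have Y_lim: "Y \<midarrow>p\<rightarrow> N * deriv J p / (1 - 0)"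
    unfolding Y_def by (intro tendsto_intros dJ_lim contJ) auto
  have y_lim: "y \<midarrow>p\<rightarrow> N * deriv J p"
    using Y_lim tendsto_cong[OF y_eq] by simp
  have wy_lim: "(\<lambda>w. (w - p) * y w) \<midarrow>p\<rightarrow> 0"
  proof -
    have "(\<lambda>w. (w - p) * y w) \<midarrow>p\<rightarrow> (p - p) * (N * deriv J p)"
      by (intro tendsto_intros y_lim)
    then show ?thesis by simp
  qed
  \<comment> \<open>The value comes from the equation for \<open>x\<close>: multiplied by
    \<open>(w - p)^2\<close> and divided by \<open>(w - p) * x w\<close>, it becomes
    \<open>- N = 2 * S * \<beta> + N * n / M2\<close> in the limit.\<close>
  define \<beta> where "\<beta> = - N * (1 + of_nat n / M2) / (2 * S)"
  have t_lim: "(\<lambda>w. (w - p) * t w) \<midarrow>p\<rightarrow> \<beta>"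
  proof -
    have d: "(\<lambda>w. (w - p)\<^sup>2 * deriv x w) \<midarrow>p\<rightarrow> - (- N * of_nat n)"
      using x_lim holx \<open>r > 0\<close> by (intro deriv_simple_pole_tendsto[of "ball p r"]) auto
    have "(\<lambda>w. (N * ((w - p)\<^sup>2 * deriv x w) / ((w - p) * x w)
            + (1 / M1 + 1) * ((w - p) * y w) + (w - p) * x w / M2) / (2 * S)) \<midarrow>p\<rightarrow>
          (N * (- (- N * of_nat n)) / (- N * of_nat n)
            + (1 / M1 + 1) * 0 + (- N * of_nat n) / M2) / (2 * S)"
      by (intro tendsto_intros d x_lim wy_lim) (use N0 n M S0 in auto)
    also have "(N * (- (- N * of_nat n)) / (- N * of_nat n)
            + (1 / M1 + 1) * 0 + (- N * of_nat n) / M2) / (2 * S) = \<beta>"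
      using N0 n M S0 by (simp add: \<beta>_def field_simps)
    finally have *: "(\<lambda>w. (N * ((w - p)\<^sup>2 * deriv x w) / ((w - p) * x w)
            + (1 / M1 + 1) * ((w - p) * y w) + (w - p) * x w / M2) / (2 * S)) \<midarrow>p\<rightarrow> \<beta>" .
    have "eventually (\<lambda>w. x w \<noteq> 0) (at p)"
      using tendsto_imp_eventually_ne[OF x_lim, of 0] N0 n by (auto elim: eventually_mono)
    then have "eventually (\<lambda>w. (N * ((w - p)\<^sup>2 * deriv x w) / ((w - p) * x w)
            + (1 / M1 + 1) * ((w - p) * y w) + (w - p) * x w / M2) / (2 * S) = (w - p) * t w) (at p)"
      using near
    proof eventually_elim
      case (elim w)
      have divide: "N * (D\<^sup>2 * d) / (D * X) = D * L" if "N * d = X * L" "D \<noteq> 0" "X \<noteq> 0"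
        for D d X L :: complex
      proof -
        have "N * (D\<^sup>2 * d) = D\<^sup>2 * (X * L)" using that(1) by (metis mult.left_commute)
        then show ?thesis using that by (simp only: nonzero_divide_eq_eq mult_eq_0_iff power2_eq_square) simp
      qed
      have "N * ((w - p)\<^sup>2 * deriv x w) / ((w - p) * x w)
          = (w - p) * (2 * S * t w - (1 / M1 + 1) * y w - x w / M2)"
        by (rule divide) (use dx[of w] elim in \<open>auto simp: qd M1_def M2_def\<close>)
      then show ?case using S0 M by (simp add: field_simps)
    qed
    then show ?thesis using * by (simp add: tendsto_cong)
  qed
  \<comment> \<open>Coefficients of the double pole in the Riccati equation for \<open>t\<close>;
    the product \<open>x * y\<close> has at most a simple pole and drops out.\<close>
  have "- N * \<beta> = S * \<beta>\<^sup>2"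
  proof -
    have d: "(\<lambda>w. (w - p)\<^sup>2 * deriv t w) \<midarrow>p\<rightarrow> - \<beta>"
      using t_lim holt \<open>r > 0\<close> by (intro deriv_simple_pole_tendsto[of "ball p r"]) auto
    have 1: "(\<lambda>w. N * ((w - p)\<^sup>2 * deriv t w)) \<midarrow>p\<rightarrow> N * - \<beta>"
      by (intro tendsto_intros d)
    have 2: "(\<lambda>w. S * (((w - p) * t w)\<^sup>2 - ((w - p) * x w) * ((w - p) * y w))) \<midarrow>p\<rightarrow>
        S * (\<beta>\<^sup>2 - (- N * of_nat n) * 0)"
      by (intro tendsto_intros t_lim x_lim wy_lim)
    have "eventually (\<lambda>w. N * ((w - p)\<^sup>2 * deriv t w)
        = S * (((w - p) * t w)\<^sup>2 - ((w - p) * x w) * ((w - p) * y w))) (at p)"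
      using near
    proof eventually_elim
      case (elim w)
      have "N * ((w - p)\<^sup>2 * deriv t w) = (w - p)\<^sup>2 * (S * ((t w)\<^sup>2 - x w * y w))"
        using dt[OF elim] by (simp add: qd)
      then show ?case by (simp add: power2_eq_square algebra_simps)
    qed
    from Lim_transform_eventually[OF 1 this] 2
    have "N * - \<beta> = S * (\<beta>\<^sup>2 - (- N * of_nat n) * 0)"
      by (rule LIM_unique)
    then show ?thesis by simp
  qed
  \<comment> \<open>Positivity of \<open>m2 + n\<close> rules out the root 0 of the quadratic
    equation. Comparing the other root \<open>- N / S\<close> with the definition of
    \<open>\<beta>\<close> then gives \<open>n = m2\<close>.\<close>
  moreover have "\<beta> \<noteq> 0"
  proof -
    have "M2 + of_nat n = of_int (m2 + int n)" by (simp add: M2_def)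
    moreover have "m2 + int n \<noteq> 0" using m by linarith
    ultimately have "M2 + of_nat n \<noteq> 0" by (metis of_int_eq_0_iff)
    moreover have "1 + of_nat n / M2 = (M2 + of_nat n) / M2" using M by (simp add: add_divide_distrib)
    ultimately show ?thesis using M N0 S0 by (simp add: \<beta>_def)
  qed
  ultimately have \<beta>: "S * \<beta> = - N"
    by (metis mult_right_cancel power2_eq_square mult.assoc)
  have "2 * (S * \<beta>) = - N * (1 + of_nat n / M2)"
    using S0 by (simp add: \<beta>_def)
  then have "N * (1 + of_nat n / M2 - 2) = 0"
    unfolding \<beta> by (simp add: algebra_simps)
  then have "1 + of_nat n / M2 = 2" using N0 by simp
  then have nM: "of_nat n = M2" using M by (simp add: field_simps)
  have "int n = m2"
  proof -
    have "complex_of_int (int n) = of_int m2" using nM by (simp add: M2_def)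
    then show ?thesis by (simp only: of_int_eq_iff)
  qed
  then have n2: "n \<ge> 2" using m by simp
  \<comment> \<open>Because \<open>n \<ge> 2\<close>, the function \<open>y\<close>, a regular
    multiple of \<open>deriv J\<close>, vanishes at \<open>p\<close>. This zero cancels the simple
    pole of \<open>x\<close> in \<open>x * y\<close>.\<close>
  have dJp: "deriv J p = 0"
    using dJ[of p] \<rho> n2 by (simp add: power_0_left)
  show "\<exists>c. (\<lambda>w. x w * y w) \<midarrow>p\<rightarrow> c"
  proof -
    have "(deriv J has_field_derivative deriv (deriv J) p) (at p)"
      using \<open>r > 0\<close> by (intro holomorphic_derivI[OF holomorphic_deriv[OF holJ open_ball] open_ball]) auto
    then have d: "(\<lambda>w. deriv J w / (w - p)) \<midarrow>p\<rightarrow> deriv (deriv J) p"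
      by (simp add: has_field_derivative_iff dJp)
    have 1: "(\<lambda>w. (w - p) * x w * (N * (deriv J w / (w - p)) / (1 - J w))) \<midarrow>p\<rightarrow>
        - N * of_nat n * (N * deriv (deriv J) p / (1 - 0))"
      by (intro tendsto_intros d x_lim contJ) auto
    have "eventually (\<lambda>w. (w - p) * x w * (N * (deriv J w / (w - p)) / (1 - J w)) = x w * y w) (at p)"
      using near y_eq by eventually_elim (auto simp: Y_def)
    from Lim_transform_eventually[OF 1 this] show ?thesis by blast
  qed
  show "\<exists>c. (\<lambda>w. 2 * of_int m1 * x w + 2 * of_int m2 * y w + of_int (m1 + m2 + m1 * m2) * t w)
           \<midarrow>p\<rightarrow> c"
  proof (rule removable_of_zero_residue[of "ball p r"])
    \<comment> \<open>With \<open>n = M2\<close> and \<open>S * \<beta> = - N\<close>, the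
      contributions of \<open>x\<close> and \<open>t\<close> to the residue are
      \<open>- 2 * M1 * M2 * N\<close> and \<open>2 * M1 * M2 * N\<close>.\<close>
    define e where
      "e = (\<lambda>w. 2 * of_int m1 * x w + 2 * of_int m2 * y w + of_int (m1 + m2 + m1 * m2) * t w)"
    have "(\<lambda>w. 2 * M1 * ((w - p) * x w) + 2 * M2 * ((w - p) * y w)
          + (M1 * M2 + M1 + M2) * ((w - p) * t w)) \<midarrow>p\<rightarrow>
        2 * M1 * (- N * of_nat n) + 2 * M2 * 0 + (M1 * M2 + M1 + M2) * \<beta>"
      by (intro tendsto_intros x_lim wy_lim t_lim)
    also have "(\<lambda>w. 2 * M1 * ((w - p) * x w) + 2 * M2 * ((w - p) * y w)
          + (M1 * M2 + M1 + M2) * ((w - p) * t w)) = (\<lambda>w. (w - p) * e w)"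
      by (auto simp: e_def M1_def M2_def algebra_simps)
    also have "(M1 * M2 + M1 + M2) * \<beta> = - (2 * M1 * M2 * S) * \<beta>"
      using S2 by simp
    also have "\<dots> = 2 * M1 * M2 * N" using \<beta> by (simp add: algebra_simps)
    finally show "(\<lambda>w. (w - p) * (2 * of_int m1 * x w + 2 * of_int m2 * y w
        + of_int (m1 + m2 + m1 * m2) * t w)) \<midarrow>p\<rightarrow> 0"
      by (simp add: nM e_def)
  qed (use \<open>r > 0\<close> in \<open>auto intro!: holomorphic_intros holx holy holt\<close>)
qed

text \<open>Holomorphic functions on a connected open set have no zero divisors: \<open>f\<close>
  vanishes on the open set where \<open>g\<close> does not, which contains \<open>\<xi>\<close>, and
  the identity theorem does the rest.\<close>

lemma holomorphic_mult_zero_imp_zero: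
  fixes f g :: "complex \<Rightarrow> complex"
  assumes "open R" "connected R" "f holomorphic_on R" "g holomorphic_on R"
    and zero: "\<And>z. z \<in> R \<Longrightarrow> f z * g z = 0" and nz: "\<xi> \<in> R" "g \<xi> \<noteq> 0" and "z \<in> R"
  shows "f z = 0"
proof (rule analytic_continuation_open[of "{z \<in> R. g z \<noteq> 0}" R f "\<lambda>_. 0"])
  show "open {z \<in> R. g z \<noteq> 0}"
    using continuous_open_preimage[OF holomorphic_on_imp_continuous_on[OF \<open>g holomorphic_on R\<close>]
        \<open>open R\<close>, of "- {0}"]
    by (auto simp: vimage_def Int_def)
qed (use assms in auto)

text \<open>This is the differential equation divided by \<open>E^4\<close>, with \<open>l\<close>,
  \<open>Q\<close>, \<open>P\<close> in the roles of \<open>DE / E\<close>, \<open>D2E / E\<close>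
  and \<open>E\<close>. The variables are \<open>X = x / m2\<close> and \<open>Y = y / m1\<close>,
  which makes all coefficients polynomials in \<open>m1\<close> and \<open>m2\<close>.\<close>

lemma weight_24_identity:
  fixes m1 m2 :: int and X Y :: complex
  defines "M1 \<equiv> of_int m1" and "M2 \<equiv> of_int m2"
  defines "l \<equiv> (2 - M1) * Y + (2 - M2) * X"
  defines "Q \<equiv> l\<^sup>2 + 2 * (X + Y) * l - (2 - M1) * Y * ((1 + M2) * X + Y)
    - (2 - M2) * X * ((1 + M1) * Y + X)"
  defines "P \<equiv> M1 * M2 * X * Y"
  shows "of_int (C88 m1 m2) * Q\<^sup>2 + of_int (C86 m1 m2) * l\<^sup>2 * Q + of_int (C84 m1 m2) * P * Q
    + of_int (C66 m1 m2) * l ^ 4 + of_int (C64 m1 m2) * P * l\<^sup>2 + of_int (C44 m1 m2) * P\<^sup>2 = 0"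
  unfolding C88_def C86_def C84_def C66_def C64_def C44_def P_def Q_def l_def of_int_mult of_int_add
    of_int_diff of_int_power of_int_minus of_int_numeral M1_def[symmetric] M2_def[symmetric]
  by algebra

theorem theorem3p3:
  fixes m1 m2 :: int and s :: real and \<kappa> :: complex
    and J t1 t2 t3 E2 E DE D2E :: "complex \<Rightarrow> complex"
  assumes "2 \<le> m1" and "m1 \<le> m2" and "(m1, m2) \<noteq> (2, 2)"
    and "standard_hauptmodul m1 m2 s J"
    and "halphen_solution m1 m2 J \<kappa> t1 t2 t3"
    and "E2 = eisenstein2 m1 m2 t1 t2 t3"
    and "(\<lambda>\<tau>. E2 \<tau> - 1) \<in> O[at_i_inf](nome)"
    and "E = eisenstein4 t1 t2 t3"
    and "DE = serre_deriv m1 m2 E2 4 E"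
    and "D2E = serre_deriv m1 m2 E2 6 DE"
  shows "\<forall>\<tau>\<in>upper_half_plane.
      of_int (C88 m1 m2) * E \<tau> ^ 2 * D2E \<tau> ^ 2
    + of_int (C86 m1 m2) * E \<tau> * DE \<tau> ^ 2 * D2E \<tau>
    + of_int (C84 m1 m2) * E \<tau> ^ 4 * D2E \<tau>
    + of_int (C66 m1 m2) * DE \<tau> ^ 4
    + of_int (C64 m1 m2) * E \<tau> ^ 3 * DE \<tau> ^ 2
    + of_int (C44 m1 m2) * E \<tau> ^ 6 = 0"
proof -

  \<comment> \<open>Constants attached to the type of the triangle\<close>
  let ?H = upper_half_plane
  define R where "R = regular_points J"
  define k :: complex where "k = 2 * of_real pi * \<i>"
  have k0: "k \<noteq> 0" by (simp add: k_def)
  have dq: "deriv f w = k * qderiv f w" for f w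
    by (simp add: qderiv_def k_def)
  define M1 M2 :: complex where "M1 = of_int m1" and "M2 = of_int m2"
  define u v where "u = 1 / M1" and "v = 1 / M2"
  define S where "S = - (1 + u + v) / 2"
  have M: "M1 \<noteq> 0" "M2 \<noteq> 0" using assms(1,2) by (auto simp: M1_def M2_def)
  define K where "K = M1 + M2 - M1 * M2"
  have K0: "K \<noteq> 0"
  proof -
    \<comment> \<open>Hyperbolicity \<open>1/m1 + 1/m2 < 1\<close> in integer form; the left-hand
      side equals \<open>1 - (m1 + m2 - m1 * m2)\<close>.\<close>
    have "(m1 - 1) * (m2 - 1) > 1"
    proof (cases "m1 = 2")
      case True
      then show ?thesis using assms(2,3) by auto
    next
      case False
      then have "2 * 2 \<le> (m1 - 1) * (m2 - 1)" using assms(1,2) by (intro mult_mono) auto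
      then show ?thesis by simp
    qed
    then have "m1 + m2 - m1 * m2 \<noteq> 0" by (simp add: algebra_simps)
    moreover have "K = of_int (m1 + m2 - m1 * m2)" by (simp add: K_def M1_def M2_def)
    ultimately show ?thesis by (metis of_int_eq_0_iff)
  qed

  \<comment> \<open>The regular points as a connected open set\<close>
  have H: "open ?H" "connected ?H"
    by (simp_all add: upper_half_plane_def open_halfspace_Im_gt convex_connected
        convex_halfspace_Im_gt)
  have holJ: "J holomorphic_on ?H" and surjJ: "J ` ?H = UNIV"
    and limJ: "filterlim J at_infinity at_i_inf"
    using assms(4) by (simp_all add: standard_hauptmodul_def)
  have R_iff: "\<tau> \<in> R \<longleftrightarrow> \<tau> \<in> ?H \<and> J \<tau> \<noteq> 0 \<and> J \<tau> \<noteq> 1" for \<tau>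
    by (simp add: R_def regular_points_def)
  have ne: "eventually (\<lambda>\<tau>. J \<tau> \<noteq> c) (at p)" if p: "p \<in> ?H" for p c
  proof (cases "J p = c")
    case True
    \<comment> \<open>Any value other than \<open>c\<close> would do: it witnesses that
      \<open>J - c\<close> is not identically 0, so that its zeros are isolated.\<close>
    obtain \<beta> where \<beta>: "\<beta> \<in> ?H" "J \<beta> = c + 1" using surjJ by (metis UNIV_I imageE)
    have "(\<lambda>\<tau>. J \<tau> - c) holomorphic_on ?H" by (intro holomorphic_intros holJ)
    then obtain r where "r > 0" "\<And>z. z \<in> ball p r - {p} \<Longrightarrow> J z - c \<noteq> 0"
      by (rule isolated_zeros[OF _ H p, where \<beta> = \<beta>]) (use True \<beta> in auto)
    then show ?thesis
      by (auto simp: eventually_at dist_commute)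
  next
    case False
    have "isCont J p"
      using holomorphic_on_imp_continuous_on[OF holJ] H that
      by (simp add: continuous_on_eq_continuous_at)
    then have "eventually (\<lambda>\<tau>. J \<tau> \<in> - {c}) (at p)"
      using False by (intro topological_tendstoD) (auto simp: isCont_def)
    then show ?thesis by simp
  qed
  have punctured: "\<exists>r>0. ball p r \<subseteq> ?H \<and> ball p r - {p} \<subseteq> R" if "p \<in> ?H" for p
  proof -
    obtain r where r: "r > 0" "ball p r \<subseteq> ?H" using H(1) \<open>p \<in> ?H\<close> openE by blast
    have "eventually (\<lambda>\<tau>. J \<tau> \<noteq> 0 \<and> J \<tau> \<noteq> 1) (at p)"
      using ne[OF that] by (simp add: eventually_conj)
    then obtain d where d: "d > 0" "\<And>z. z \<noteq> p \<Longrightarrow> dist z p < d \<Longrightarrow> J z \<noteq> 0 \<and> J z \<noteq> 1"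
      by (auto simp: eventually_at)
    have "ball p (min r d) \<subseteq> ?H" using r(2) by auto
    moreover have "ball p (min r d) - {p} \<subseteq> R"
    proof
      fix z assume "z \<in> ball p (min r d) - {p}"
      then have "z \<noteq> p" "dist z p < d" "z \<in> ?H" using r(2) by (auto simp: dist_commute)
      then show "z \<in> R" using d(2) by (simp add: R_iff)
    qed
    ultimately show ?thesis using r(1) d(1) by (intro exI[of _ "min r d"]) simp
  qed
  \<comment> \<open>Removing a sparse set from a connected open set leaves it connected, which the
    identity theorem on \<open>R\<close> requires.\<close>
  have "{\<tau>. J \<tau> = 0 \<or> J \<tau> = 1} sparse_in ?H"
    unfolding sparse_in_eventually_iff[OF H(1)] using ne by (auto simp: eventually_conj_iff)
  moreover have R_diff: "R = ?H - {\<tau>. J \<tau> = 0 \<or> J \<tau> = 1}" by (auto simp: R_iff)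
  ultimately have R: "open R" "connected R"
    using H by (auto intro: open_diff_sparse_pts sparse_imp_connected)
  have R_H: "R \<subseteq> ?H" by (auto simp: R_iff)

  \<comment> \<open>Differential equations for \<open>x\<close>, \<open>y\<close> and
    \<open>t\<close>\<close>
  define x y t where "x = (\<lambda>\<tau>. t1 \<tau> - t2 \<tau>)" and "y = (\<lambda>\<tau>. t3 \<tau> - t2 \<tau>)" and "t = t2"
  have hol_t: "t1 holomorphic_on R" "t2 holomorphic_on R" "t3 holomorphic_on R"
    and halphen: "halphen_system (par_a m1 m2) (par_b m1 m2) (par_c m1 m2) t1 t2 t3 R"
    and cusp: "\<forall>\<^sub>F \<tau> in at_i_inf. t2 \<tau> - t1 \<tau> = \<kappa> * (1 - 1 / (1 - J \<tau>)) powr (par_b m1 m2 - par_a m1 m2)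
          * (hyp2F1 (1 - par_a m1 m2) (par_b m1 m2) 1 (1 / (1 - J \<tau>)))\<^sup>2
        \<and> t3 \<tau> - t1 \<tau> = \<kappa> * (1 / (1 - J \<tau>)) * (1 - 1 / (1 - J \<tau>)) powr (par_b m1 m2 - par_a m1 m2)
          * (hyp2F1 (1 - par_a m1 m2) (par_b m1 m2) 1 (1 / (1 - J \<tau>)))\<^sup>2"
    using assms(5) by (auto simp: halphen_solution_def R_def Let_def elim!: eventually_mono)
  have hol: "x holomorphic_on R" "y holomorphic_on R" "t holomorphic_on R"
    unfolding x_def y_def t_def by (intro holomorphic_intros hol_t)+
  have holJR: "J holomorphic_on R" using holJ R_H holomorphic_on_subset by blast
  have D: "(f has_field_derivative k * qderiv f \<tau>) (at \<tau>)" if "f holomorphic_on R" "\<tau> \<in> R" for f \<tau>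
    using holomorphic_derivI[OF that(1) R(1) that(2)] by (simp add: dq)
  have qI: "qderiv f \<tau> = d" if "(f has_field_derivative k * d) (at \<tau>)" for f \<tau> d
    using DERIV_imp_deriv[OF that] k0 by (simp add: dq)
  have par: "par_a m1 m2 = (1 - u + v) / 2" "par_b m1 m2 = (1 - u - v) / 2"
    "par_c m1 m2 = (1 + u - v) / 2"
    by (simp_all add: par_a_def par_b_def par_c_def u_def v_def M1_def M2_def)
  \<comment> \<open>The Halphen right-hand sides for \<open>t1\<close> and \<open>t2\<close> agree
    where \<open>t1 = t2\<close>, hence the factor \<open>x\<close>; similarly for \<open>y\<close>.
    The variable \<open>t\<close> enters both logarithmic derivatives through the same term
    \<open>2 * S * t\<close>, which the Serre derivative will remove.\<close>
  have dx: "qderiv x \<tau> = x \<tau> * (2 * S * t \<tau> - (u + 1) * y \<tau> - v * x \<tau>)"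
    and dy: "qderiv y \<tau> = y \<tau> * (2 * S * t \<tau> - (v + 1) * x \<tau> - u * y \<tau>)"
    and dt: "qderiv t \<tau> = S * ((t \<tau>)\<^sup>2 - x \<tau> * y \<tau>)" if "\<tau> \<in> R" for \<tau>
  proof -
    have "(x has_field_derivative k * (qderiv t1 \<tau> - qderiv t2 \<tau>)) (at \<tau>)"
      "(y has_field_derivative k * (qderiv t3 \<tau> - qderiv t2 \<tau>)) (at \<tau>)"
      unfolding x_def y_def
      by (auto intro!: derivative_eq_intros D hol_t that simp: algebra_simps)
    then have q: "qderiv x \<tau> = qderiv t1 \<tau> - qderiv t2 \<tau>" "qderiv y \<tau> = qderiv t3 \<tau> - qderiv t2 \<tau>"
      by (auto intro: qI)
    have h:
      "qderiv t1 \<tau> = ((1 - u + v) / 2 - 1) * (t1 \<tau> * t2 \<tau> + t1 \<tau> * t3 \<tau> - t2 \<tau> * t3 \<tau>)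
        + ((1 - u - v) / 2 + (1 + u - v) / 2 - 1) * (t1 \<tau>)\<^sup>2"
      "qderiv t2 \<tau> = ((1 - u - v) / 2 - 1) * (t2 \<tau> * t3 \<tau> + t2 \<tau> * t1 \<tau> - t1 \<tau> * t3 \<tau>)
        + ((1 - u + v) / 2 + (1 + u - v) / 2 - 1) * (t2 \<tau>)\<^sup>2"
      "qderiv t3 \<tau> = ((1 + u - v) / 2 - 1) * (t3 \<tau> * t1 \<tau> + t3 \<tau> * t2 \<tau> - t1 \<tau> * t2 \<tau>)
        + ((1 - u + v) / 2 + (1 - u - v) / 2 - 1) * (t3 \<tau>)\<^sup>2"
      using halphen that unfolding halphen_system_def par by auto
    show "qderiv x \<tau> = x \<tau> * (2 * S * t \<tau> - (u + 1) * y \<tau> - v * x \<tau>)"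
      unfolding q h unfolding x_def y_def t_def S_def by (simp add: field_simps power2_eq_square)
    show "qderiv y \<tau> = y \<tau> * (2 * S * t \<tau> - (v + 1) * x \<tau> - u * y \<tau>)"
      unfolding q h unfolding x_def y_def t_def S_def by (simp add: field_simps power2_eq_square)
    show "qderiv t \<tau> = S * ((t \<tau>)\<^sup>2 - x \<tau> * y \<tau>)"
      unfolding t_def h unfolding x_def y_def S_def by (simp add: field_simps power2_eq_square)
  qed

  \<comment> \<open>The algebraic relation between \<open>J\<close>, \<open>x\<close> and
    \<open>y\<close>\<close>
  have rel: "(1 - J \<tau>) * y \<tau> = - J \<tau> * x \<tau>" if "\<tau> \<in> R" for \<tau>
  proof -
    have "eventually (\<lambda>\<tau>. (1 - J \<tau>) * y \<tau> = - J \<tau> * x \<tau> \<and> J \<tau> \<noteq> 0 \<and> J \<tau> \<noteq> 1) at_i_inf"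
      using cusp filterlim_at_infinity_imp_eventually_ne[OF limJ, of 0]
        filterlim_at_infinity_imp_eventually_ne[OF limJ, of 1]
    proof eventually_elim
      case (elim \<tau>)
      have "(1 - J \<tau>) * (t3 \<tau> - t1 \<tau>) = t2 \<tau> - t1 \<tau>"
        using elim by simp
      then show ?case using elim by (simp add: x_def y_def algebra_simps)
    qed
    then obtain B where B: "\<And>\<tau>. Im \<tau> > B \<Longrightarrow> (1 - J \<tau>) * y \<tau> = - J \<tau> * x \<tau> \<and> J \<tau> \<noteq> 0 \<and> J \<tau> \<noteq> 1"
      unfolding at_i_inf_def eventually_filtercomap_at_top_dense by auto
    show ?thesis
    \<comment> \<open>The bound 0 keeps the half-plane inside \<open>?H\<close>, and the bound
      \<open>B\<close> keeps \<open>J\<close> away from the values 0 and 1, so the half-plane lies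
      in \<open>R\<close>.\<close>
    proof (rule analytic_continuation_open[of "{\<tau>. Im \<tau> > max B 0}" R
          "\<lambda>\<tau>. (1 - J \<tau>) * y \<tau>" "\<lambda>\<tau>. - J \<tau> * x \<tau>"])
      show "open {\<tau>. Im \<tau> > max B 0}" by (rule open_halfspace_Im_gt)
      have "Complex 0 (max B 0 + 1) \<in> {\<tau>. Im \<tau> > max B 0}" by (simp add: max_def)
      then show "{\<tau>. Im \<tau> > max B 0} \<noteq> {}" by blast
      show "{\<tau>. Im \<tau> > max B 0} \<subseteq> R" using B by (auto simp: R_iff upper_half_plane_def)
    qed (use B R that in \<open>auto intro!: holomorphic_intros hol holJR\<close>)
  qed

  \<comment> \<open>Eisenstein series and Serre derivatives at regular points\<close>
  have E_R: "E \<tau> = x \<tau> * y \<tau>" if "\<tau> \<in> R" for \<tau>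
  proof -
    have "(\<lambda>\<tau>. x \<tau> * y \<tau>) analytic_on {\<tau>}"
      using R that hol by (auto intro!: holomorphic_intros simp: analytic_at)
    then show ?thesis
      using assms(8) by (simp add: eisenstein4_def x_def y_def)
  qed
  define e where "e = (\<lambda>\<tau>. 1 / K * (2 * M1 * x \<tau> + 2 * M2 * y \<tau> + (M1 + M2 + M1 * M2) * t \<tau>))"
  have E2_e: "E2 = remove_sings e"
    using assms(6) by (simp add: eisenstein2_def e_def x_def y_def t_def K_def M1_def M2_def fun_eq_iff)
  have hole: "e holomorphic_on R"
    unfolding e_def by (intro holomorphic_intros hol)
  have E2_R: "E2 \<tau> = e \<tau>" if "\<tau> \<in> R" for \<tau>
  proof -
    have "e analytic_on {\<tau>}"
      using R that hole by (auto simp: analytic_at)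
    then show ?thesis by (simp add: E2_e)
  qed
  \<comment> \<open>The prefactor \<open>1 / K\<close> of \<open>E2\<close> cancels against
    \<open>1 - u - v = - K / (M1 * M2)\<close>. What remains contains \<open>- 2 * S * t\<close>
    once for every two units of weight, exactly balancing the \<open>t\<close>-terms of
    \<open>dx\<close> and \<open>dy\<close>.\<close>
  have serre: "serre_deriv m1 m2 E2 n f \<tau>
      = qderiv f \<tau> + of_nat n / 2 * (2 * v * x \<tau> + 2 * u * y \<tau> - 2 * S * t \<tau>) * f \<tau>"
    if "\<tau> \<in> R" for n f \<tau>
  proof -
    have e: "(1 - u - v) * E2 \<tau> = - (2 * v * x \<tau> + 2 * u * y \<tau> - 2 * S * t \<tau>)"
    proof -
      have "1 - u - v = - K / (M1 * M2)" using M by (simp add: K_def u_def v_def field_simps)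
      moreover define W where "W = 2 * M1 * x \<tau> + 2 * M2 * y \<tau> + (M1 + M2 + M1 * M2) * t \<tau>"
      moreover have "E2 \<tau> = W / K" by (simp add: E2_R[OF that] e_def W_def)
      ultimately have "(1 - u - v) * E2 \<tau> = - (W / (M1 * M2))"
        using K0 by simp
      also have "\<dots> = - (2 * v * x \<tau> + 2 * u * y \<tau> - 2 * S * t \<tau>)"
        using M by (simp add: W_def S_def u_def v_def field_simps)
      finally show ?thesis .
    qed
    have "serre_deriv m1 m2 E2 n f \<tau> = qderiv f \<tau> - of_nat n / 2 * ((1 - u - v) * E2 \<tau>) * f \<tau>"
      by (simp only: serre_deriv_def u_def v_def M1_def M2_def mult.assoc)
    then show ?thesis unfolding e mult_minus_right mult_minus_left by simp
  qed
  define l where "l = (\<lambda>\<tau>. (2 * u - 1) * y \<tau> + (2 * v - 1) * x \<tau>)"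
  \<comment> \<open>By the product rule with weights 4 + 2 = 6, \<open>Q\<close> is the square of
    \<open>l\<close> plus the weight-2 Serre derivative of \<open>l\<close>; the terms with
    \<open>t\<close> have cancelled.\<close>
  define Q where "Q = (\<lambda>\<tau>. (l \<tau>)\<^sup>2 + 2 * (v * x \<tau> + u * y \<tau>) * l \<tau>
      - (2 * u - 1) * y \<tau> * ((v + 1) * x \<tau> + u * y \<tau>)
      - (2 * v - 1) * x \<tau> * ((u + 1) * y \<tau> + v * x \<tau>))"
  have R_ev: "eventually (\<lambda>w. w \<in> R) (nhds \<tau>)" if "\<tau> \<in> R" for \<tau>
    using R(1) that by (rule eventually_nhds_in_open)
  have q_cong: "qderiv f \<tau> = qderiv g \<tau>" if "\<tau> \<in> R" "\<And>w. w \<in> R \<Longrightarrow> f w = g w" for f g \<tau>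
    unfolding qderiv_def
    by (rule arg_cong[where f = "\<lambda>z. z / _"], rule deriv_cong_ev)
      (use R_ev[OF that(1)] that(2) in \<open>auto elim: eventually_mono\<close>)
  have DE_R: "DE \<tau> = x \<tau> * y \<tau> * l \<tau>" if "\<tau> \<in> R" for \<tau>
  proof -
    have "qderiv E \<tau> = qderiv (\<lambda>w. x w * y w) \<tau>" by (intro q_cong that E_R)
    also have "\<dots> = qderiv x \<tau> * y \<tau> + x \<tau> * qderiv y \<tau>"
      by (rule qI) (auto intro!: derivative_eq_intros D hol that simp: algebra_simps)
    finally show ?thesis
      unfolding assms(9) serre[OF that] E_R[OF that] dx[OF that] dy[OF that]
      by (simp add: l_def algebra_simps)
  qed
  have D2E_R: "D2E \<tau> = x \<tau> * y \<tau> * Q \<tau>" if "\<tau> \<in> R" for \<tau>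
  proof -
    have "qderiv DE \<tau> = qderiv (\<lambda>w. x w * y w * l w) \<tau>" by (intro q_cong that DE_R)
    also have "\<dots> = (qderiv x \<tau> * y \<tau> + x \<tau> * qderiv y \<tau>) * l \<tau>
        + x \<tau> * y \<tau> * ((2 * u - 1) * qderiv y \<tau> + (2 * v - 1) * qderiv x \<tau>)"
      unfolding l_def
      by (rule qI) (auto intro!: derivative_eq_intros D hol that simp: algebra_simps)
    finally show ?thesis
      unfolding assms(10) serre[OF that] DE_R[OF that] dx[OF that] dy[OF that]
      by (simp add: Q_def l_def algebra_simps power2_eq_square)
  qed

  \<comment> \<open>The differential equation at regular points\<close>
  define G where "G = (\<lambda>\<tau>. of_int (C88 m1 m2) * E \<tau> ^ 2 * D2E \<tau> ^ 2
    + of_int (C86 m1 m2) * E \<tau> * DE \<tau> ^ 2 * D2E \<tau>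
    + of_int (C84 m1 m2) * E \<tau> ^ 4 * D2E \<tau>
    + of_int (C66 m1 m2) * DE \<tau> ^ 4
    + of_int (C64 m1 m2) * E \<tau> ^ 3 * DE \<tau> ^ 2
    + of_int (C44 m1 m2) * E \<tau> ^ 6)"
  have G_R: "G \<tau> = 0" if "\<tau> \<in> R" for \<tau>
  proof -
    \<comment> \<open>Rescaling absorbs the denominators \<open>u\<close> and \<open>v\<close> and
      brings \<open>l\<close>, \<open>Q\<close> and \<open>x * y\<close> into the form of
      \<open>weight_24_identity\<close>.\<close>
    define X Y where "X = v * x \<tau>" and "Y = u * y \<tau>"
    have xy: "x \<tau> = M2 * X" "y \<tau> = M1 * Y" using M by (simp_all add: X_def Y_def u_def v_def)
    have l': "l \<tau> = (2 - M1) * Y + (2 - M2) * X"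
      using M by (simp add: l_def X_def Y_def u_def v_def field_simps)
    have vx: "v * x \<tau> = X" "u * y \<tau> = Y" by (simp_all add: X_def Y_def)
    have "(2 * u - 1) * y \<tau> = (2 - M1) * Y" "(2 * v - 1) * x \<tau> = (2 - M2) * X"
      "(v + 1) * x \<tau> = (1 + M2) * X" "(u + 1) * y \<tau> = (1 + M1) * Y"
      using M by (simp_all add: X_def Y_def u_def v_def field_simps)
    then have Q': "Q \<tau> = (l \<tau>)\<^sup>2 + 2 * (X + Y) * l \<tau> - (2 - M1) * Y * ((1 + M2) * X + Y)
        - (2 - M2) * X * ((1 + M1) * Y + X)"
      by (simp add: Q_def vx)
    have P: "x \<tau> * y \<tau> = M1 * M2 * X * Y" by (simp add: xy)
    have "G \<tau> = (x \<tau> * y \<tau>) ^ 4 * (of_int (C88 m1 m2) * (Q \<tau>)\<^sup>2 + of_int (C86 m1 m2) * (l \<tau>)\<^sup>2 * Q \<tau>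
        + of_int (C84 m1 m2) * (x \<tau> * y \<tau>) * Q \<tau> + of_int (C66 m1 m2) * l \<tau> ^ 4
        + of_int (C64 m1 m2) * (x \<tau> * y \<tau>) * (l \<tau>)\<^sup>2 + of_int (C44 m1 m2) * (x \<tau> * y \<tau>)\<^sup>2)"
      unfolding G_def E_R[OF that] DE_R[OF that] D2E_R[OF that] by algebra
    also have "\<dots> = 0"
      using weight_24_identity[where ?m1.0 = m1 and ?m2.0 = m2 and X = X and Y = Y]
      unfolding P Q' l' M1_def M2_def by (simp only: mult_zero_right)
    finally show ?thesis .
  qed

  \<comment> \<open>Extension to the elliptic points\<close>
  show ?thesis
  proof (cases "\<exists>\<xi>\<in>R. x \<xi> \<noteq> 0")
    case True
    then obtain \<xi> where \<xi>: "\<xi> \<in> R" "x \<xi> \<noteq> 0" by blast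
    have dJx: "qderiv J \<tau> = - J \<tau> * x \<tau>" if "\<tau> \<in> R" for \<tau>
    proof -
      have "(\<lambda>\<tau>. qderiv J \<tau> + J \<tau> * x \<tau>) holomorphic_on R"
        unfolding qderiv_def by (intro holomorphic_intros holJR hol holomorphic_deriv R) auto
      \<comment> \<open>Differentiating \<open>rel\<close> and eliminating with \<open>rel\<close>
        gives \<open>(qderiv J + J * x) * (x - y) = 0\<close>, in which \<open>S\<close> and
        \<open>t\<close> no longer occur. Multiplication by \<open>1 - J\<close> turns the second
        factor into \<open>x\<close>, again by \<open>rel\<close>.\<close>
      moreover have "(qderiv J \<tau> + J \<tau> * x \<tau>) * x \<tau> = 0" if "\<tau> \<in> R" for \<tau>
      proof -
        have "qderiv (\<lambda>w. (1 - J w) * y w) \<tau> = qderiv (\<lambda>w. - J w * x w) \<tau>"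
          by (intro q_cong that rel)
        moreover have "qderiv (\<lambda>w. (1 - J w) * y w) \<tau> = - qderiv J \<tau> * y \<tau> + (1 - J \<tau>) * qderiv y \<tau>"
          by (rule qI) (auto intro!: derivative_eq_intros D hol holJR that simp: algebra_simps)
        moreover have "qderiv (\<lambda>w. - J w * x w) \<tau> = - qderiv J \<tau> * x \<tau> - J \<tau> * qderiv x \<tau>"
          by (rule qI) (auto intro!: derivative_eq_intros D hol holJR that simp: algebra_simps)
        ultimately have "- qderiv J \<tau> * y \<tau> + (1 - J \<tau>) * qderiv y \<tau>
            = - qderiv J \<tau> * x \<tau> - J \<tau> * qderiv x \<tau>" by simp
        then show ?thesis
          using rel[OF that] unfolding dx[OF that] dy[OF that] by algebra
      qed
      \<comment> \<open>Since \<open>x\<close> may have zeros, it is cancelled as a function on the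
        connected set \<open>R\<close>, not pointwise.\<close>
      ultimately have "qderiv J \<tau> + J \<tau> * x \<tau> = 0"
        using holomorphic_mult_zero_imp_zero[OF R _ hol(1) _ \<xi> that] by blast
      then show ?thesis by (simp add: eq_neg_iff_add_eq_0)
    qed
    have dJy: "qderiv J \<tau> = (1 - J \<tau>) * y \<tau>" if "\<tau> \<in> R" for \<tau>
      using dJx[OF that] rel[OF that] by simp
    have m2: "2 \<le> m2" using assms(1,2) by simp
    \<comment> \<open>The constants are spelled out in both orders of \<open>m1\<close> and
      \<open>m2\<close> to match the two instances of \<open>elliptic_point_limits\<close>.\<close>
    have dx': "qderiv x w = x w * (2 * (- (1 + 1 / of_int m1 + 1 / of_int m2) / 2) * t w
          - (1 / of_int m1 + 1) * y w - x w / of_int m2)"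
      and dy': "qderiv y w = y w * (2 * (- (1 + 1 / of_int m2 + 1 / of_int m1) / 2) * t w
          - (1 / of_int m2 + 1) * x w - y w / of_int m1)"
      and dt': "qderiv t w = - (1 + 1 / of_int m1 + 1 / of_int m2) / 2 * ((t w)\<^sup>2 - x w * y w)"
      and dt'': "qderiv t w = - (1 + 1 / of_int m2 + 1 / of_int m1) / 2 * ((t w)\<^sup>2 - y w * x w)"
      if "w \<in> R" for w
      unfolding dx[OF that] dy[OF that] dt[OF that] S_def u_def v_def M1_def M2_def
      by (simp_all add: algebra_simps)
    have lims: "(\<exists>c. (\<lambda>w. x w * y w) \<midarrow>p\<rightarrow> c) \<and>
        (\<exists>c. (\<lambda>w. 2 * M1 * x w + 2 * M2 * y w + (M1 + M2 + M1 * M2) * t w) \<midarrow>p\<rightarrow> c)"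
      if p: "p \<in> ?H" for p
    proof -
      obtain r where r: "r > 0" "ball p r \<subseteq> ?H" "ball p r - {p} \<subseteq> R"
        using punctured[OF p] by blast
      have holJr: "J holomorphic_on ball p r" using holJ r(2) holomorphic_on_subset by blast
      have holr: "x holomorphic_on ball p r - {p}" "y holomorphic_on ball p r - {p}"
        "t holomorphic_on ball p r - {p}"
        using hol r(3) holomorphic_on_subset by blast+
      have inR: "w \<in> R" if "w \<in> ball p r - {p}" for w using that r(3) by blast
      consider "p \<in> R" | "J p = 0" | "J p = 1" using p R_iff by blast
      then show ?thesis
      proof cases
        case 1
        then have c: "x \<midarrow>p\<rightarrow> x p" "y \<midarrow>p\<rightarrow> y p" "t \<midarrow>p\<rightarrow> t p"
          using hol R(1) holomorphic_on_imp_continuous_on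
          by (metis continuous_on_eq_continuous_at isContD)+
        show ?thesis by (intro conjI exI) (rule tendsto_intros c)+
      next
        case 2
        have "w \<in> R \<Longrightarrow> J w \<noteq> 0" for w by (simp add: R_iff)
        note lim = elliptic_point_limits[OF assms(1) m2 r(1) holJr 2 this[OF inR] holr(1,3,2)
            dJx[OF inR] dJy[OF inR] dx'[OF inR] dt'[OF inR]]
        from lim show ?thesis by (simp add: M1_def M2_def)
      next
        case 3
        \<comment> \<open>Passing to \<open>1 - J\<close> swaps \<open>dJx\<close> and
          \<open>dJy\<close>, so the roles of \<open>x\<close>, \<open>m1\<close> and
          \<open>y\<close>, \<open>m2\<close> are exchanged.\<close>
        have J': "qderiv (\<lambda>w. 1 - J w) \<tau> = - qderiv J \<tau>" if "\<tau> \<in> R" for \<tau>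
          by (rule qI) (auto intro!: derivative_eq_intros D holJR that)
        have 1: "(\<lambda>w. 1 - J w) holomorphic_on ball p r" "1 - J p = 0"
          using 3 by (auto intro!: holomorphic_intros holJr)
        have 2: "w \<in> R \<Longrightarrow> 1 - J w \<noteq> 0"
          "w \<in> R \<Longrightarrow> qderiv (\<lambda>w. 1 - J w) w = - (1 - J w) * y w"
          "w \<in> R \<Longrightarrow> qderiv (\<lambda>w. 1 - J w) w = (1 - (1 - J w)) * x w" for w
          subgoal by (simp add: R_iff)
          subgoal by (simp only: J' dJy mult_minus_left)
          subgoal by (simp add: J' dJx)
          done
        note lim = elliptic_point_limits[OF m2 assms(1) r(1) 1 2(1)[OF inR] holr(2,3,1)
            2(2,3)[OF inR] dy'[OF inR] dt''[OF inR]]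
        from lim show ?thesis by (simp add: M1_def M2_def mult_ac add_ac)
      qed
    qed
    have sing: "isolated_singularity_at f p" if f: "f holomorphic_on R" and p: "p \<in> ?H" for f p
    proof -
      obtain r where r: "r > 0" "ball p r - {p} \<subseteq> R"
        using punctured[OF p] by blast
      then have "f holomorphic_on ball p r - {p}" using f holomorphic_on_subset by blast
      then show ?thesis
        using r(1) by (auto simp: isolated_singularity_at_def analytic_on_open open_delete)
    qed
    have holE: "E holomorphic_on ?H"
      unfolding assms(8) eisenstein4_def
    proof (rule remove_sings_holomorphic_on[OF H(1)])
      fix p assume p: "p \<in> ?H"
      have "(\<lambda>\<tau>. x \<tau> * y \<tau>) holomorphic_on R" by (intro holomorphic_intros hol)
      then show "isolated_singularity_at (\<lambda>\<tau>. (t1 \<tau> - t2 \<tau>) * (t3 \<tau> - t2 \<tau>)) p"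
        using sing[OF _ p] by (simp add: x_def y_def)
      show "\<exists>c. (\<lambda>\<tau>. (t1 \<tau> - t2 \<tau>) * (t3 \<tau> - t2 \<tau>)) \<midarrow>p\<rightarrow> c"
        using lims[OF p] by (simp add: x_def y_def)
    qed
    have holE2: "E2 holomorphic_on ?H"
      unfolding E2_e
    proof (rule remove_sings_holomorphic_on[OF H(1)])
      fix p assume p: "p \<in> ?H"
      then show "isolated_singularity_at e p" by (rule sing[OF hole])
      show "\<exists>c. e \<midarrow>p\<rightarrow> c" unfolding e_def using lims[OF p] tendsto_mult_left by blast
    qed
    have holS: "serre_deriv m1 m2 E2 n f holomorphic_on ?H" if "f holomorphic_on ?H" for n f
    proof -
      have "(\<lambda>\<tau>. serre_deriv m1 m2 E2 n f \<tau>) holomorphic_on ?H"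
        unfolding serre_deriv_def qderiv_def
        by (intro holomorphic_intros holE2 that holomorphic_deriv H) auto
      then show ?thesis .
    qed
    have holD: "DE holomorphic_on ?H" "D2E holomorphic_on ?H"
      unfolding assms(9,10) by (intro holS holE)+
    have "G holomorphic_on ?H"
      unfolding G_def by (intro holomorphic_intros holE holD)
    then have "G \<tau> = 0" if "\<tau> \<in> ?H" for \<tau>
      using analytic_continuation_open[of R ?H G "\<lambda>_. 0" \<tau>] R H R_H \<xi>(1) G_R that by auto
    then show ?thesis by (simp add: G_def)
  next
    case False
    \<comment> \<open>Outside \<open>R\<close> the value of \<open>E\<close> is the limit of
      \<open>x * y\<close> along regular points, where \<open>x\<close> is 0.\<close>
    have E0: "E \<tau> = 0" if "\<tau> \<in> ?H" for \<tau>
    proof -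
      obtain r where r: "r > 0" "ball \<tau> r - {\<tau>} \<subseteq> R" using punctured[OF \<open>\<tau> \<in> ?H\<close>] by blast
      have "eventually (\<lambda>w. w \<in> ball \<tau> r - {\<tau>}) (at \<tau>)"
        using r(1) by (intro eventually_at_in_open) auto
      then have "eventually (\<lambda>w. 0 = x w * y w) (at \<tau>)"
        by eventually_elim (use r(2) False in auto)
      from Lim_transform_eventually[OF tendsto_const this]
      show ?thesis
        unfolding assms(8) eisenstein4_def x_def y_def by (rule remove_sings_eqI)
    qed
    have S0: "serre_deriv m1 m2 E2 n f \<tau> = 0" if "\<And>\<tau>. \<tau> \<in> ?H \<Longrightarrow> f \<tau> = 0" "\<tau> \<in> ?H" for n f \<tau>
    proof -
      have "deriv f \<tau> = deriv (\<lambda>_. 0) \<tau>"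
        using eventually_nhds_in_open[OF H(1) that(2)]
        by (intro deriv_cong_ev) (auto elim!: eventually_mono simp: that(1))
      then show ?thesis using that by (simp add: serre_deriv_def qderiv_def)
    qed
    have DE0: "DE \<tau> = 0" if "\<tau> \<in> ?H" for \<tau>
      unfolding assms(9) using that by (intro S0 E0)
    have "D2E \<tau> = 0" if "\<tau> \<in> ?H" for \<tau>
      unfolding assms(10) using that by (intro S0 DE0)
    with DE0 show ?thesis using E0 by simp
  qed
qed

end
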